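(* Let $\mathcal I$ be an ideal on $\omega$, let $\mathcal K\subseteq\mathcal I$ be hereditary and tall, and let $\mathcal B$ be a barrier on an infinite set $M\subseteq\omega$. If $\mathcal I$ is $\mathcal B$-Ramsey, then for every $X\in\mathcal I^+$ with $X\subseteq M$ there is $H\in\mathcal I^+$, $H\subseteq X$, with $\mathcal B\upharpoonright H\subseteq\mathcal K$.
   Context: All ideals on $\omega$ are proper and contain all finite sets. $\mathcal I^+=\mathcal P(\omega)\setminus\mathcal I$. A family of subsets of $\omega$ is tall if every infinite subset of $\omega$ has an infinite subset in it; it is hereditary if closed under subsets. For infinite $M\subseteq\omega$, a barrier on $M$ is a family $\mathcal B$ of nonempty finite subsets of $M$ such that every infinite subset of $M$ has an initial segment in $\mathcal B$ and no member of $\mathcal B$ is a proper subset of another. $\mathcal B\upharpoonright X=\{s\in\mathcal B:s\subseteq X\}$. $\mathcal I$ is $\mathcal B$-Ramsey if for every $X\in\mathcal I^+$ with $X\subseteq M$ and every colouring of $\mathcal B\upharpoonright X$ with finitely many colours there is $H\subseteq X$, $H\in\mathcal I^+$, such that the colouring is constant on $\mathcal B\upharpoonright H$. *)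

theory Defs
  imports Main
begin

definition ideal_on_omega :: "nat set set \<Rightarrow> bool" where
  "ideal_on_omega I \<longleftrightarrow>
     (\<forall>A. finite A \<longrightarrow> A \<in> I) \<and>
     (\<forall>A B. A \<in> I \<longrightarrow> B \<subseteq> A \<longrightarrow> B \<in> I) \<and>
     (\<forall>A B. A \<in> I \<longrightarrow> B \<in> I \<longrightarrow> A \<union> B \<in> I) \<and>
     UNIV \<notin> I"

definition positive :: "nat set set \<Rightarrow> nat set set" where
  "positive I = - I"

definition hereditary :: "nat set set \<Rightarrow> bool" where
  "hereditary F \<longleftrightarrow> (\<forall>A B. A \<in> F \<longrightarrow> B \<subseteq> A \<longrightarrow> B \<in> F)"

definition tall :: "nat set set \<Rightarrow> bool" where
  "tall F \<longleftrightarrow> (\<forall>A. infinite A \<longrightarrow> (\<exists>B. B \<subseteq> A \<and> infinite B \<and> B \<in> F))"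

definition initial_segment :: "nat set \<Rightarrow> nat set \<Rightarrow> bool" where
  "initial_segment s A \<longleftrightarrow> s \<subseteq> A \<and> (\<forall>m\<in>s. \<forall>n\<in>A. n < m \<longrightarrow> n \<in> s)"

definition barrier_on :: "nat set \<Rightarrow> nat set set \<Rightarrow> bool" where
  "barrier_on M B \<longleftrightarrow>
     (\<forall>s\<in>B. finite s \<and> s \<noteq> {} \<and> s \<subseteq> M) \<and>
     (\<forall>A. A \<subseteq> M \<longrightarrow> infinite A \<longrightarrow> (\<exists>s\<in>B. initial_segment s A)) \<and>
     (\<forall>s\<in>B. \<forall>t\<in>B. \<not> s \<subset> t)"

definition restr :: "nat set set \<Rightarrow> nat set \<Rightarrow> nat set set" where
  "restr B X = {s \<in> B. s \<subseteq> X}"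

text \<open>A colouring of \<open>restr B X\<close> with the \<open>k\<close> colours \<open>{..<k}\<close> is given by a total
  function \<open>c\<close>; its values outside \<open>restr B X\<close> are unconstrained and irrelevant.\<close>

definition barrier_Ramsey :: "nat set \<Rightarrow> nat set set \<Rightarrow> nat set set \<Rightarrow> bool" where
  "barrier_Ramsey M B I \<longleftrightarrow>
     (\<forall>X \<in> positive I. X \<subseteq> M \<longrightarrow>
        (\<forall>(k::nat) (c :: nat set \<Rightarrow> nat). (\<forall>s \<in> restr B X. c s < k) \<longrightarrow>
           (\<exists>H \<in> positive I. H \<subseteq> X \<and> (\<exists>j. \<forall>s \<in> restr B H. c s = j))))"

end

theory Submission
  imports Defs
begin

text \<open>Colour a member of \<open>B\<close> by whether it lies in \<open>K\<close>. The Ramsey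
  property gives a positive \<open>H\<close> inside \<open>X\<close> on which this colouring is
  constant, so it is enough to find one member of \<open>restr B H\<close> in \<open>K\<close>.
  Tallness provides an infinite subset of \<open>H\<close> in \<open>K\<close>, the barrier contains
  an initial segment of it, and heredity keeps that segment in \<open>K\<close>.\<close>

theorem lemma6p1:
  fixes I K B :: "nat set set" and M :: "nat set"
  assumes "ideal_on_omega I"
    and "K \<subseteq> I" and "hereditary K" and "tall K"
    and "infinite M" and "barrier_on M B"
    and "barrier_Ramsey M B I"
  shows "\<forall>X \<in> positive I. X \<subseteq> M \<longrightarrow> (\<exists>H \<in> positive I. H \<subseteq> X \<and> restr B H \<subseteq> K)"
proof (intro ballI impI)
  fix X assume X: "X \<in> positive I" "X \<subseteq> M"
  define c :: "nat set \<Rightarrow> nat" where "c s = (if s \<in> K then 0 else 1)" for s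
  have "\<forall>s \<in> restr B X. c s < 2"
    by (simp add: c_def)
  with assms(7)[unfolded barrier_Ramsey_def, rule_format, OF X, of c 2] obtain H j
    where H: "H \<in> positive I" "H \<subseteq> X" and j: "\<forall>s \<in> restr B H. c s = j"
    by blast
  have "infinite H"
    using H(1) assms(1) by (auto simp: ideal_on_omega_def positive_def)
  \<comment> \<open>\<open>A\<close> lies in \<open>I\<close>, so it cannot replace
    \<open>H\<close>; it serves only to reveal which colour \<open>H\<close> received.\<close>
  with assms(4) obtain A where A: "A \<subseteq> H" "infinite A" "A \<in> K"
    unfolding tall_def by blast
  moreover from A(1) H(2) X(2) have "A \<subseteq> M"
    by simp
  ultimately obtain s where s: "s \<in> B" "initial_segment s A"
    using assms(6) unfolding barrier_on_def by blast
  then have "s \<subseteq> A"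
    by (simp add: initial_segment_def)
  with assms(3) A have "s \<in> K" and "s \<in> restr B H"
    using s(1) by (auto simp: hereditary_def restr_def)
  \<comment> \<open>The witness \<open>s\<close> shows that \<open>restr B H\<close> is nonempty, so
    the constant \<open>j\<close> is a colour actually taken there.\<close>
  with j have "j = 0"
    by (auto simp: c_def)
  with j have "restr B H \<subseteq> K"
    by (auto simp: c_def split: if_splits)
  with H show "\<exists>H \<in> positive I. H \<subseteq> X \<and> restr B H \<subseteq> K"
    by blast
qed

end
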